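(* Let $n \in \mathbb{Z}^+$ and $z \in \mathbb{C}$ with $\Re(z) > 0$. Define $$U_{2n}(z) := \sum_{k \in \mathbb{Z}} \frac{1}{k^{2n} + z^{2n}}.$$ Then the series admits the integral representation $$U_{2n}(z) = \int_0^1 q^{z^{2n}-1} \cdot \Psi_n(q)\, dq,$$ where $$\Psi_n(q) := \sum_{k \in \mathbb{Z}} q^{k^{2n}}.$$
   Context: $\mathbb{Z}^+$ denotes the positive integers. The function $\Psi_n$ is called the generalized Jacobi theta function.
   Formalization: The formal theorem additionally assumes Re(z^{2n}) > 0, because for Re(z) > 0 alone the integral can diverge (for example n = 1, z = 1+2i); this condition is exactly what is needed for the integral to converge. *)

theory Defs
  imports "HOL-Analysis.Analysis"
begin

definition U :: "nat \<Rightarrow> complex \<Rightarrow> complex" where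
  "U m z = (\<Sum>\<^sub>\<infinity>k::int. 1 / (of_int k ^ m + z ^ m))"

text \<open>
  The exponent \<open>k ^ (2 * n)\<close> is an integer, so the integer power is used; in particular
  no choice of a branch of the logarithm enters. The series converges for \<open>norm q < 1\<close>.
\<close>
definition Psi :: "nat \<Rightarrow> complex \<Rightarrow> complex" where
  "Psi n q = (\<Sum>\<^sub>\<infinity>k::int. q powi (k ^ (2 * n)))"

end

theory Submission
  imports Defs
begin

text \<open>
  Put \<open>w = z ^ (2 * n)\<close>, so that \<open>Re w > 0\<close>. For each \<open>k\<close>, the function
  \<open>q powr (w - 1) * q ^ (k ^ (2 * n)) = q powr (w + k ^ (2 * n) - 1)\<close> has integral
  \<open>1 / (k ^ (2 * n) + w)\<close> over the unit interval, and its norm has integral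
  \<open>1 / (k ^ (2 * n) + Re w)\<close>. The latter is summable over the integers, so sum and integral
  may be exchanged by dominated convergence.
\<close>

text \<open>The integers split into two copies of the naturals, \<open>k \<ge> 0\<close> and
  \<open>k < 0\<close>. By evenness the negative half carries the same terms as the tail of the
  nonnegative half.\<close>

lemma summable_on_int_even:
  fixes f :: "int \<Rightarrow> 'a :: banach"
  assumes even: "\<And>k. f (- k) = f k"
    and summable: "summable (\<lambda>m. norm (f (int m)))"
  shows "f summable_on UNIV"
proof -
  have "(\<lambda>m. f (int m)) summable_on UNIV"
    using summable by (rule norm_summable_imp_summable_on)
  then have nonneg: "f summable_on {0..}"
    by (subst summable_on_reindex_bij_betw[of int UNIV, symmetric])
      (rule bij_betwI[of _ _ _ nat], auto)
  \<comment> \<open>The shift by one keeps the index 0 out of the negative half, so that it is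
    counted once.\<close>
  have "(\<lambda>m. f (int (Suc m))) summable_on UNIV"
    using summable
    by (intro norm_summable_imp_summable_on) (subst summable_Suc_iff)
  then have "(\<lambda>m. f (- int (Suc m))) summable_on UNIV"
    by (simp only: even)
  then have neg: "f summable_on {..<0}"
    by (subst summable_on_reindex_bij_betw[of "\<lambda>m. - int (Suc m)" UNIV, symmetric])
      (rule bij_betwI[of _ _ _ "\<lambda>k. nat (- k - 1)"], auto)
  have "f summable_on {0..} \<union> {..<0}"
    using nonneg neg by (rule summable_on_Un_disjoint) auto
  also have "{0..} \<union> {..<0} = (UNIV :: int set)"
    by auto
  finally show ?thesis .
qed

text \<open>The exchange of sum and integral for series over the naturals is transported along the
  bijection \<open>int_decode\<close>. Absolute summability makes the order of this enumeration
  irrelevant.\<close>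

lemma has_bochner_integral_infsum_int:
  fixes f :: "int \<Rightarrow> 'a \<Rightarrow> 'b :: {banach, second_countable_topology}"
  assumes integrable: "\<And>k. integrable M (f k)"
    and summable: "\<And>x. x \<in> space M \<Longrightarrow> (\<lambda>k. norm (f k x)) summable_on UNIV"
    and summable_integral: "(\<lambda>k. LINT x|M. norm (f k x)) summable_on UNIV"
  shows "has_bochner_integral M (\<lambda>x. \<Sum>\<^sub>\<infinity>k. f k x) (\<Sum>\<^sub>\<infinity>k. LINT x|M. f k x)"
proof -
  define g where "g m = f (int_decode m)" for m
  have reindex: "(\<lambda>m. h (int_decode m)) summable_on UNIV \<longleftrightarrow> h summable_on UNIV"
    for h :: "int \<Rightarrow> real"
    by (rule summable_on_reindex_bij_betw[OF bij_int_decode])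
  have suminf: "(\<Sum>m. h (int_decode m)) = (\<Sum>\<^sub>\<infinity>k. h k)"
    if "(\<lambda>k. norm (h k)) summable_on UNIV" for h :: "int \<Rightarrow> 'b"
  proof -
    have "(h has_sum (\<Sum>\<^sub>\<infinity>k. h k)) UNIV"
      by (rule has_sum_infsum[OF abs_summable_summable[OF that]])
    then have "((\<lambda>m. h (int_decode m)) has_sum (\<Sum>\<^sub>\<infinity>k. h k)) UNIV"
      by (simp add: has_sum_reindex_bij_betw[OF bij_int_decode])
    then show ?thesis
      by (metis has_sum_imp_sums sums_unique)
  qed
  have g1: "integrable M (g m)" for m
    by (simp add: g_def integrable)
  have g2: "AE x in M. summable (\<lambda>m. norm (g m x))"
    using summable
    by (intro AE_I2 summable_on_imp_summable) (simp add: g_def reindex[of "\<lambda>k. norm (f k _)"])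
  have g3: "summable (\<lambda>m. LINT x|M. norm (g m x))"
    using summable_integral
    by (intro summable_on_imp_summable)
      (simp add: g_def reindex[of "\<lambda>k. LINT x|M. norm (f k x)"])
  \<comment> \<open>The series of integrals must itself be absolutely summable before it may be
    reordered by \<open>suminf\<close>.\<close>
  have "norm (LINT x|M. f k x) \<le> (LINT x|M. norm (f k x))" for k
    by (rule integral_norm_bound)
  then have "(\<lambda>k. norm (LINT x|M. f k x)) summable_on UNIV"
    by (intro summable_on_comparison_test[OF summable_integral]) auto
  then have "(\<Sum>m. LINT x|M. g m x) = (\<Sum>\<^sub>\<infinity>k. LINT x|M. f k x)"
    unfolding g_def by (rule suminf)
  then have "has_bochner_integral M (\<lambda>x. \<Sum>m. g m x) (\<Sum>\<^sub>\<infinity>k. LINT x|M. f k x)"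
    using integrable_suminf[OF g1 g2 g3] integral_suminf[OF g1 g2 g3]
    by (simp add: has_bochner_integral_iff)
  moreover have "(\<Sum>m. g m x) = (\<Sum>\<^sub>\<infinity>k. f k x)" if "x \<in> space M" for x
    unfolding g_def using summable[OF that] by (rule suminf)
  ultimately show ?thesis
    by (simp cong: has_bochner_integral_cong)
qed

lemma set_integral_powr_unit_interval:
  fixes a :: real
  assumes "a > 0"
  shows "set_integrable lborel {0<..<1} (\<lambda>q. q powr (a - 1))"
    and "(LINT q:{0<..<1}|lborel. q powr (a - 1)) = 1 / a"
proof -
  have "((\<lambda>q. q powr (a - 1)) has_integral 1 / a) {0..1}"
    using has_integral_powr_from_0[of "a - 1" 1] assms by simp
  then have I: "((\<lambda>q. q powr (a - 1)) has_integral 1 / a) {0<..<1}"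
    by (simp add: has_integral_Icc_iff_Ioo)
  \<comment> \<open>A nonnegative gauge-integrable function is absolutely integrable. By Borel
    measurability, integrability then passes from the completed measure to
    \<open>lborel\<close>.\<close>
  then have "(\<lambda>q. q powr (a - 1)) absolutely_integrable_on {0<..<1}"
    by (intro nonnegative_absolutely_integrable_1) auto
  then show *: "set_integrable lborel {0<..<1} (\<lambda>q. q powr (a - 1))"
    unfolding set_integrable_def by (subst (asm) integrable_completion) auto
  show "(LINT q:{0<..<1}|lborel. q powr (a - 1)) = 1 / a"
    using set_borel_integral_eq_integral(2)[OF *] I by (simp add: integral_unique)
qed

lemma norm_of_real_powr:
  "q > 0 \<Longrightarrow> norm (complex_of_real q powr s) = q powr Re s"
  by (simp add: norm_powr_real_powr)

text \<open>The real case with exponent \<open>Re s - 1\<close> dominates the integrand; the value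
  comes from the antiderivative \<open>q powr s / s\<close>.\<close>

lemma set_integral_complex_powr_unit_interval:
  fixes s :: complex
  assumes "Re s > 0"
  shows "set_integrable lborel {0<..<1} (\<lambda>q. complex_of_real q powr (s - 1))"
    and "(LINT q:{0<..<1}|lborel. complex_of_real q powr (s - 1)) = 1 / s"
proof -
  have "s \<noteq> 0"
    using assms by auto
  show *: "set_integrable lborel {0<..<1} (\<lambda>q. complex_of_real q powr (s - 1))"
  proof (rule set_integrable_bound)
    show "set_integrable lborel {0<..<1} (\<lambda>q. q powr (Re s - 1))"
      using assms by (rule set_integral_powr_unit_interval)
    show "set_borel_measurable lborel {0<..<1} (\<lambda>q. complex_of_real q powr (s - 1))"
      unfolding set_borel_measurable_def measurable_lborel2
      by (intro borel_measurable_continuous_on_indicator) (auto intro!: continuous_intros)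
  qed (auto simp: norm_of_real_powr)
  \<comment> \<open>The integrand may blow up at 0, so the derivative is taken only in the interior.
    The antiderivative is still continuous at 0, with value 0, because
    \<open>Re s > 0\<close>.\<close>
  have "((\<lambda>q. complex_of_real q powr (s - 1)) has_integral
          complex_of_real 1 powr s / s - complex_of_real 0 powr s / s) {0..1}"
    using assms \<open>s \<noteq> 0\<close>
    by (intro fundamental_theorem_of_calculus_interior)
      (auto intro!: continuous_intros derivative_eq_intros has_vector_derivative_real_field)
  then have "((\<lambda>q. complex_of_real q powr (s - 1)) has_integral 1 / s) {0<..<1}"
    by (simp add: has_integral_Icc_iff_Ioo)
  then show "(LINT q:{0<..<1}|lborel. complex_of_real q powr (s - 1)) = 1 / s"
    using set_borel_integral_eq_integral(2)[OF *] by (simp add: integral_unique)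
qed

lemma summable_on_inverse_int_power:
  fixes a :: real and m :: nat
  assumes "a > 0" and "even m" and "m \<ge> 2"
  shows "(\<lambda>k::int. 1 / (of_int k ^ m + a)) summable_on UNIV"
proof (rule summable_on_int_even)
  show "1 / (of_int (- k) ^ m + a) = 1 / (of_int k ^ m + a)" for k :: int
    using \<open>even m\<close> by simp
  show "summable (\<lambda>j. norm (1 / (of_int (int j) ^ m + a)))"
  proof (rule summable_comparison_test')
    show "summable (\<lambda>j. inverse (real j ^ m))"
      using \<open>m \<ge> 2\<close> by (rule inverse_power_summable)
    fix j :: nat
    \<comment> \<open>At \<open>j = 0\<close> the bound fails: \<open>inverse (0 ^ m)\<close> is 0,
      whereas the term is \<open>1 / a\<close>.\<close>
    assume "j \<ge> 1"
    then show "norm (norm (1 / (of_int (int j) ^ m + a))) \<le> inverse (real j ^ m)"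
      using \<open>a > 0\<close> by (simp add: field_simps add_pos_pos)
  qed
qed

lemma summable_on_power_int_power:
  fixes q :: real and m :: nat
  assumes "0 < q" and "q < 1" and "even m" and "m \<ge> 1"
  shows "(\<lambda>k::int. q powi (k ^ m)) summable_on UNIV"
proof (rule summable_on_int_even)
  show "q powi ((- k) ^ m) = q powi (k ^ m)" for k
    using \<open>even m\<close> by simp
  show "summable (\<lambda>j. norm (q powi (int j ^ m)))"
  proof (rule summable_comparison_test')
    show "summable (\<lambda>j. q ^ j)"
      using assms by (simp add: summable_geometric)
    fix j :: nat
    \<comment> \<open>Since \<open>q < 1\<close>, larger exponents give smaller powers, and a
      geometric series dominates.\<close>
    have "j \<le> j ^ m"
      using \<open>m \<ge> 1\<close> by (cases "j = 0") (auto intro: self_le_power)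
    then have "q ^ (j ^ m) \<le> q ^ j"
      using assms by (intro power_decreasing) auto
    moreover have "q powi (int j ^ m) = q ^ (j ^ m)"
      by (metis of_nat_power power_int_of_nat)
    ultimately show "norm (norm (q powi (int j ^ m))) \<le> q ^ j"
      using assms by simp
  qed
qed

text \<open>The condition on \<open>Re (z ^ (2 * n))\<close> is about the endpoint 0: there
  \<open>Psi n q\<close> tends to 1, its term at \<open>k = 0\<close>, so absolute integrability
  requires that of \<open>q powr (z ^ (2 * n) - 1)\<close>. The open interval leaves out
  \<open>q = 1\<close>, where the theta series diverges.\<close>

theorem theorem2p7:
  fixes n :: nat and z :: complex
  assumes "n \<ge> 1"
    and "Re z > 0"
    and "Re (z ^ (2 * n)) > 0"
  shows "(\<lambda>k::int. 1 / (of_int k ^ (2 * n) + z ^ (2 * n))) summable_on UNIV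
    \<and> (\<forall>q::real. 0 < q \<and> q < 1 \<longrightarrow>
          (\<lambda>k::int. complex_of_real q powi (k ^ (2 * n))) summable_on UNIV)
    \<and> set_integrable lborel {0<..<1}
          (\<lambda>q::real. complex_of_real q powr (z ^ (2 * n) - 1) * Psi n (complex_of_real q))
    \<and> U (2 * n) z =
          (LINT q:{0<..<1}|lborel.
             complex_of_real q powr (z ^ (2 * n) - 1) * Psi n (complex_of_real q))"
proof -
  define w where "w = z ^ (2 * n)"
  define s where "s k = of_int k ^ (2 * n) + w" for k :: int
  \<comment> \<open>The indicator makes each term a function on the whole line that vanishes off the
    unit interval, so the series can be summed at every real \<open>q\<close>.\<close>
  define f where
    "f = (\<lambda>k q. indicator {0<..<1} q *\<^sub>R complex_of_real q powr (s k - 1))"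
  have w: "Re w > 0"
    using assms by (simp add: w_def)
  have Re_s: "Re (s k) = of_int k ^ (2 * n) + Re w" for k
  proof -
    have "s k = of_real (of_int k ^ (2 * n)) + w"
      by (simp add: s_def)
    then show ?thesis
      by (simp only: plus_complex.sel Re_complex_of_real)
  qed
  \<comment> \<open>The exponent \<open>2 * n\<close> is even, so the power of \<open>k\<close> is
    nonnegative also for negative \<open>k\<close>.\<close>
  have Re_s_pos: "Re (s k) > 0" for k
    unfolding Re_s using w by (intro add_nonneg_pos) auto
  have summable_inverse_s: "(\<lambda>k. 1 / Re (s k)) summable_on UNIV"
    unfolding Re_s using w assms by (intro summable_on_inverse_int_power) auto

  \<comment> \<open>Comparison with \<open>1 / Re (s k)\<close>, as the norm of \<open>s k\<close>
    is at least its positive real part.\<close>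
  have "(\<lambda>k. 1 / s k) summable_on UNIV"
  proof (rule abs_summable_summable)
    show "(\<lambda>k. norm (1 / s k)) summable_on UNIV"
      using Re_s_pos complex_Re_le_cmod
      by (intro summable_on_comparison_test[OF summable_inverse_s])
        (auto simp: norm_divide intro!: divide_left_mono mult_pos_pos
          intro: less_le_trans)
  qed
  moreover have norm_powi:
    "(\<lambda>k::int. norm (complex_of_real q powi (k ^ (2 * n)))) summable_on UNIV"
    if "0 < q" "q < 1" for q
    using summable_on_power_int_power[OF that, of "2 * n"] assms that
    by (simp add: norm_power_int)
  \<comment> \<open>The factor \<open>q powr (w - 1)\<close> does not depend on \<open>k\<close>;
    pulling it out of the sum leaves exactly the series of \<open>Psi\<close>.\<close>
  moreover have powr_s:
    "complex_of_real q powr (s k - 1)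
      = complex_of_real q powr (w - 1) * complex_of_real q powi (k ^ (2 * n))"
    if "q > 0" for q k
  proof -
    have "s k - 1 = (w - 1) + of_int (k ^ (2 * n))"
      by (simp add: s_def)
    then show ?thesis
      using that by (simp only: powr_add) (simp add: complex_powr_of_int flip: of_int_power)
  qed
  have int_f: "integrable lborel (f k)" "(LINT q|lborel. f k q) = 1 / s k" for k
    using set_integral_complex_powr_unit_interval[OF Re_s_pos, of k]
    by (simp_all add: f_def set_integrable_def set_lebesgue_integral_def)
  have norm_f: "norm (f k q) = indicator {0<..<1} q *\<^sub>R q powr (Re (s k) - 1)" for k q
    by (auto simp: f_def norm_of_real_powr indicator_def)
  have int_norm_f: "(LINT q|lborel. norm (f k q)) = 1 / Re (s k)" for k
    using set_integral_powr_unit_interval(2)[OF Re_s_pos, of k]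
    by (simp add: norm_f set_lebesgue_integral_def)
  have summable_f: "(\<lambda>k. norm (f k q)) summable_on UNIV" for q
  proof (cases "q \<in> {0<..<1}")
    case True
    then show ?thesis
      by (simp add: f_def powr_s norm_mult norm_powi summable_on_cmult_right)
  qed (simp add: f_def)
  have "has_bochner_integral lborel (\<lambda>q. \<Sum>\<^sub>\<infinity>k. f k q) (\<Sum>\<^sub>\<infinity>k. LINT q|lborel. f k q)"
    by (rule has_bochner_integral_infsum_int) (simp_all add: int_f summable_f int_norm_f
        summable_inverse_s)
  moreover have "(\<Sum>\<^sub>\<infinity>k. f k q) = indicator {0<..<1} q *\<^sub>R
      (complex_of_real q powr (w - 1) * Psi n (complex_of_real q))" for q
  proof (cases "q \<in> {0<..<1}")
    case True
    then show ?thesis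
      by (simp add: f_def powr_s Psi_def infsum_cmult_right')
  qed (simp add: f_def)
  moreover have "(\<Sum>\<^sub>\<infinity>k. LINT q|lborel. f k q) = U (2 * n) z"
    by (simp add: int_f U_def s_def w_def)
  ultimately show ?thesis
    using abs_summable_summable[OF norm_powi]
    by (simp add: has_bochner_integral_iff set_integrable_def set_lebesgue_integral_def
        s_def w_def)
qed

end
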